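(* Let $A\in\mathcal{M}_n(\mathbb{C})$ be diagonalizable, let $E\in\mathcal{M}_n(\mathbb{R})$ be fixed, and let $\lambda_i$ be a semisimple eigenvalue of $A$ with corresponding right and left eigenvectors $\upsilon_i,\omega_i$. For small real parameters $\alpha,\beta$ put $\mathcal{L}(E,\alpha,\beta)=\alpha H_E+\beta S_E$ and $M_{\alpha,\beta}=A+\mathcal{L}(E,\alpha,\beta)$, and let $(\lambda_{\alpha,\beta},\upsilon_{\alpha,\beta})$ be the eigenpair of $M_{\alpha,\beta}$ which at $\alpha=\beta=0$ equals $(\lambda_i,\upsilon_i)$. Assume that this eigenpair has continuous second order partial derivatives (with respect to $\alpha,\beta$) in the neighborhood of $\lambda_i$ and $\upsilon_i$. Then, writing $\mathcal{L}=\mathcal{L}(E,\alpha,\beta)$ and $s_i=\omega_i^*\upsilon_i$, $$\lambda_{\alpha,\beta}=\lambda_i+\frac{1}{s_i}\omega_i^*\mathcal{L}\upsilon_i-\frac{1}{s_i}\omega_i^*\mathcal{L}(A-\lambda_iI)^{+}\mathcal{L}\upsilon_i+\mathcal{O}(\alpha^3,\beta^3),$$ $$\upsilon_{\alpha,\beta}=\upsilon_i-(A-\lambda_iI)^{+}\mathcal{L}\upsilon_i+\left[(A-\lambda_iI)^{+}\mathcal{L}\right]^2\upsilon_i-\frac{1}{s_i}\left[(A-\lambda_iI)^2\right]^{+}\mathcal{L}\,\upsilon_i\,\omega_i^*\mathcal{L}\upsilon_i+\mathcal{O}(\alpha^3,\beta^3).$$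
   Context: $\mathcal{M}_n(\mathbb{C})$, $\mathcal{M}_n(\mathbb{R})$ are the algebras of $n\times n$ complex, real matrices. $H_E=\frac{E+E^*}{2}$ and $S_E=\frac{E-E^*}{2}$ are the Hermitian and skew-Hermitian parts of $E$. An eigenvalue is semisimple if it is a simple root of the minimal polynomial. The eigenvalues $\lambda_j$ of $A$ have right and left eigenvectors $A\upsilon_j=\lambda_j\upsilon_j$, $\omega_j^*A=\lambda_j\omega_j^*$, the $\upsilon_j$ forming a basis of $\mathbb{C}^n$ and $\omega_j^*\upsilon_k=0$ for $j\neq k$; $s_k=\omega_k^*\upsilon_k$. For $\mu\in\mathbb{N}$ the generalized inverse used here is $$\left[(A-\lambda_iI)^{\mu}\right]^{+}=\sum_{k\neq i}\frac{\upsilon_k\omega_k^*}{(\lambda_k-\lambda_i)^{\mu}s_k},$$ where the sum over $k\neq i$ runs over the indices with $\lambda_k\neq\lambda_i$. Let $\omega_{\alpha,\beta}$ be the left eigenvector of $M_{\alpha,\beta}$ for $\lambda_{\alpha,\beta}$. The functions $\lambda_{\alpha,\beta},\upsilon_{\alpha,\beta},\omega_{\alpha,\beta}$ are continuous, with values $\lambda_i,\upsilon_i,\omega_i$ at $\alpha=\beta=0$. $\mathcal{O}(\alpha^3,\beta^3)$ denotes a remainder of third order in $\alpha,\beta$.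
   Formalization: The eigenvector expansion is proved for eigenvectors normalized by ω_k^*υ_{α,β} = ω_k^*υ_i for all k with λ_k = λ_i; without it the claim fails, e.g. on replacing υ_{α,β} by (1+α)υ_{α,β}. The eigenvalue expansion needs no such condition. *)

theory Defs
  imports
    "HOL-Analysis.Analysis"
    "HOL-Computational_Algebra.Polynomial"
    "HOL-Library.Landau_Symbols"
begin

definition conj_transpose :: "complex^'n^'m \<Rightarrow> complex^'m^'n" where
  "conj_transpose M = (\<chi> i j. cnj (M $ j $ i))"

definition conj_vec :: "complex^'n \<Rightarrow> complex^'n" where
  "conj_vec w = (\<chi> i. cnj (w $ i))"

text \<open>The scalar \<open>w* v\<close> (conjugate-linear in the first argument) and the
  rank-one matrix \<open>v w*\<close>.\<close>

definition hdot :: "complex^'n \<Rightarrow> complex^'n \<Rightarrow> complex" where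
  "hdot w v = (\<Sum>a\<in>UNIV. cnj (w $ a) * v $ a)"

definition outer :: "complex^'n \<Rightarrow> complex^'n \<Rightarrow> complex^'n^'n" where
  "outer v w = (\<chi> a b. v $ a * cnj (w $ b))"

definition herm_part :: "complex^'n^'n \<Rightarrow> complex^'n^'n" where
  "herm_part M = (1/2) *\<^sub>R (M + conj_transpose M)"

definition skew_part :: "complex^'n^'n \<Rightarrow> complex^'n^'n" where
  "skew_part M = (1/2) *\<^sub>R (M - conj_transpose M)"

definition perturbation :: "real^'n^'n \<Rightarrow> real \<Rightarrow> real \<Rightarrow> complex^'n^'n" where
  "perturbation E \<alpha> \<beta> =
     \<alpha> *\<^sub>R herm_part (map_matrix complex_of_real E) +
     \<beta> *\<^sub>R skew_part (map_matrix complex_of_real E)"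

definition right_eigenvector :: "complex^'n^'n \<Rightarrow> complex \<Rightarrow> complex^'n \<Rightarrow> bool" where
  "right_eigenvector M l v \<longleftrightarrow> v \<noteq> 0 \<and> M *v v = l *s v"

definition left_eigenvector :: "complex^'n^'n \<Rightarrow> complex \<Rightarrow> complex^'n \<Rightarrow> bool" where
  "left_eigenvector M l w \<longleftrightarrow> w \<noteq> 0 \<and> conj_vec w v* M = l *s conj_vec w"

definition diagonalizable :: "complex^'n^'n \<Rightarrow> bool" where
  "diagonalizable M \<longleftrightarrow>
     (\<exists>(P :: complex^'n^'n) (D :: complex^'n^'n). invertible P \<and>
       (\<forall>a b. a \<noteq> b \<longrightarrow> D $ a $ b = 0) \<and> M = P ** D ** matrix_inv P)"

text \<open>The operation \<open>^\<close> on the vector type is not the matrix power.\<close>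

definition mat_power :: "complex^'n^'n \<Rightarrow> nat \<Rightarrow> complex^'n^'n" where
  "mat_power M k = (((**) M) ^^ k) (mat 1)"

definition poly_mat :: "complex poly \<Rightarrow> complex^'n^'n \<Rightarrow> complex^'n^'n" where
  "poly_mat p M = (\<Sum>k\<le>degree p. mat (coeff p k) ** mat_power M k)"

definition is_minimal_poly :: "complex^'n^'n \<Rightarrow> complex poly \<Rightarrow> bool" where
  "is_minimal_poly M p \<longleftrightarrow>
     lead_coeff p = 1 \<and> poly_mat p M = 0 \<and>
     (\<forall>q. q \<noteq> 0 \<and> poly_mat q M = 0 \<longrightarrow> degree p \<le> degree q)"

definition semisimple_eigenvalue :: "complex^'n^'n \<Rightarrow> complex \<Rightarrow> bool" where
  "semisimple_eigenvalue M l \<longleftrightarrow>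
     (\<exists>v. right_eigenvector M l v) \<and> (\<exists>p. is_minimal_poly M p \<and> order l p = 1)"

text \<open>Eigenvalues are listed with multiplicity: the values of \<open>lam\<close> may repeat.\<close>

definition eigensystem ::
    "complex^'n^'n \<Rightarrow> ('n \<Rightarrow> complex) \<Rightarrow> ('n \<Rightarrow> complex^'n) \<Rightarrow> ('n \<Rightarrow> complex^'n) \<Rightarrow> bool" where
  "eigensystem M lam v w \<longleftrightarrow>
     (\<forall>j. right_eigenvector M (lam j) (v j)) \<and>
     (\<forall>j. left_eigenvector M (lam j) (w j)) \<and>
     inj v \<and> vec.independent (range v) \<and> vec.span (range v) = UNIV \<and>
     (\<forall>j k. j \<noteq> k \<longrightarrow> hdot (w j) (v k) = 0)"

text \<open>For an eigensystem of \<open>A\<close> this is \<open>[(A - lam i I)^\<mu>]\<^sup>+\<close>.\<close>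

definition gen_inv ::
    "('n \<Rightarrow> complex) \<Rightarrow> ('n \<Rightarrow> complex^'n) \<Rightarrow> ('n \<Rightarrow> complex^'n) \<Rightarrow> 'n \<Rightarrow> nat \<Rightarrow> complex^'n^'n" where
  "gen_inv lam v w i \<mu> =
     (\<Sum>k | lam k \<noteq> lam i.
        mat (1 / ((lam k - lam i) ^ \<mu> * hdot (w k) (v k))) ** outer (v k) (w k))"

text \<open>An eigenvector is only determined up to a nonzero scalar function, so an expansion
  of it presupposes a normalization. Here the component of \<open>V z\<close> in the eigenspace of
  \<open>lam i\<close> is held equal to \<open>v i\<close>: by biorthogonality \<open>w i* V z = w i* v i\<close>, and
  \<open>w k* V z = 0\<close> for every other index with \<open>lam k = lam i\<close>. For simple \<open>lam i\<close> only
  the first condition is present, and near the base point rescaling achieves it.\<close>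

definition normalized_on ::
    "(real \<times> real) set \<Rightarrow> ('n \<Rightarrow> complex) \<Rightarrow> ('n \<Rightarrow> complex^'n) \<Rightarrow> ('n \<Rightarrow> complex^'n) \<Rightarrow> 'n \<Rightarrow>
     (real \<times> real \<Rightarrow> complex^'n) \<Rightarrow> bool" where
  "normalized_on U lam v w i V \<longleftrightarrow>
     (\<forall>z\<in>U. \<forall>k. lam k = lam i \<longrightarrow> hdot (w k) (V z) = hdot (w k) (v i))"

definition has_partials_on ::
    "(real \<times> real) set \<Rightarrow> (real \<times> real \<Rightarrow> 'a::real_normed_vector) \<Rightarrow>
     (real \<times> real \<Rightarrow> 'a) \<Rightarrow> (real \<times> real \<Rightarrow> 'a) \<Rightarrow> bool" where
  "has_partials_on U f f1 f2 \<longleftrightarrow>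
     (\<forall>(a, b)\<in>U.
        ((\<lambda>t. f (t, b)) has_vector_derivative f1 (a, b)) (at a) \<and>
        ((\<lambda>t. f (a, t)) has_vector_derivative f2 (a, b)) (at b))"

definition continuous_second_partials_on ::
    "(real \<times> real) set \<Rightarrow> (real \<times> real \<Rightarrow> 'a::real_normed_vector) \<Rightarrow> bool" where
  "continuous_second_partials_on U f \<longleftrightarrow>
     (\<exists>f1 f2 f11 f12 f21 f22.
        has_partials_on U f f1 f2 \<and>
        has_partials_on U f1 f11 f12 \<and>
        has_partials_on U f2 f21 f22 \<and>
        continuous_on U f11 \<and> continuous_on U f12 \<and>
        continuous_on U f21 \<and> continuous_on U f22)"

definition third_order_remainder :: "(real \<times> real \<Rightarrow> 'a::real_normed_vector) \<Rightarrow> bool" where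
  "third_order_remainder R \<longleftrightarrow>
     (\<lambda>z. norm (R z)) \<in> O[nhds (0, 0)](\<lambda>(\<alpha>, \<beta>). \<bar>\<alpha>\<bar> ^ 3 + \<bar>\<beta>\<bar> ^ 3)"

end

theory Submission
  imports Defs
begin

text \<open>
  Write \<open>\<mu> = Lam - lam i\<close>, \<open>D = V - v i\<close>, \<open>G = (A - lam i I)\<^sup>+\<close> and let \<open>L\<close> be the perturbation, which
  is linear in \<open>z = (\<alpha>, \<beta>)\<close>. The eigenvalue equation reads \<open>(A - lam i I) V = \<mu> V - L V\<close>.
  Since \<open>G\<close> inverts \<open>A - lam i I\<close> up to the spectral projection, the vector
  \<open>u = V - G (\<mu> V - L V)\<close> lies in the eigenspace of \<open>lam i\<close>
  (\<open>minus_gen_inv_in_eigenspace\<close>), and the normalization says exactly that \<open>u = v i\<close>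
  (\<open>eq_plus_gen_inv\<close>). In that case \<open>V\<close> solves the fixed point equation
  \<open>V = v i + G (\<mu> V - L V)\<close>. As \<open>\<mu>\<close>, \<open>L\<close> and \<open>D\<close> are of first order, iterating it twice
  expands \<open>V\<close> up to third order (\<open>eigenvector_second_order\<close>). That \<open>\<mu>\<close> and \<open>D\<close> are of first
  order comes from the smoothness of the eigenpair: bounded second partials make
  the first partials bounded near the origin, and these make the function Lipschitz at the
  origin (\<open>continuous_second_partials_imp_first_order\<close>).

  For the eigenvalue, pairing the equation with \<open>w i\<close> gives \<open>\<mu> w* V = w* L V\<close>. When \<open>lam i\<close> is a
  multiple eigenvalue and \<open>V\<close> is not normalized, \<open>u\<close> moves inside the eigenspace, and the term
  \<open>w* L (u - v i)\<close> is of second order, so it could spoil the expansion. The left eigenvectors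
  prevent this. For every \<open>u\<close> in the eigenspace, \<open>W* L u = \<mu> W* u\<close>; going to the origin along
  a ray, where \<open>L\<close> is homogeneous, shows that \<open>w* L u = m w* u\<close> holds exactly, with the
  linear form \<open>m = w* L (v i) / s\<close> (\<open>left_eigenvector_acts_as_scalar\<close>).
  Then \<open>(\<mu> - m) w* V = w* L G (\<mu> V - L V)\<close>, whose leading term is
  \<open>- w* L G L (v i)\<close> because \<open>G (v i) = 0\<close> (\<open>eigenvalue_second_order\<close>).
\<close>

section \<open>Orders of vanishing\<close>

text \<open>Landau classes need values in a normed field, so for vectors the norm is compared. The
  base point itself belongs to the filter \<open>nhds 0\<close>, hence order at least one forces
  \<open>f 0 = 0\<close>.\<close>

definition vanishes_to_order ::
    "nat \<Rightarrow> ('b::real_normed_vector \<Rightarrow> 'a::real_normed_vector) \<Rightarrow> bool" where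
  "vanishes_to_order n f \<longleftrightarrow> (\<lambda>z. norm (f z)) \<in> O[nhds 0](\<lambda>z. norm z ^ n)"

lemma vanishes_to_order_bound:
  assumes "vanishes_to_order n f" "eventually (\<lambda>z. norm (g z) \<le> c * norm (f z)) (nhds 0)"
  shows "vanishes_to_order n g"
proof -
  have "norm (norm (g z)) \<le> (\<bar>c\<bar> + 1) * norm (norm (f z))" if "norm (g z) \<le> c * norm (f z)" for z
  proof -
    have "c * norm (f z) \<le> (\<bar>c\<bar> + 1) * norm (f z)" by (intro mult_right_mono) auto
    with that show ?thesis by simp
  qed
  then have "(\<lambda>z. norm (g z)) \<in> O[nhds 0](\<lambda>z. norm (f z))"
    by (intro landau_o.bigI[where c = "\<bar>c\<bar> + 1"] eventually_mono[OF assms(2)]) auto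
  with assms(1) show ?thesis
    unfolding vanishes_to_order_def using landau_o.big_trans by blast
qed

lemma vanishes_to_order_cong:
  assumes "eventually (\<lambda>z. f z = g z) (nhds 0)" "vanishes_to_order n f"
  shows "vanishes_to_order n g"
  using assms(2) by (rule vanishes_to_order_bound[where c = 1]) (use assms(1) in \<open>auto elim: eventually_mono\<close>)

lemma vanishes_to_order_add:
  assumes "vanishes_to_order n f" "vanishes_to_order n g"
  shows "vanishes_to_order n (\<lambda>z. f z + g z)"
proof -
  have "vanishes_to_order n (\<lambda>z. norm (f z) + norm (g z))"
    using sum_in_bigo(1)[OF assms[unfolded vanishes_to_order_def]]
    unfolding vanishes_to_order_def by simp
  then show ?thesis
    by (rule vanishes_to_order_bound[where c = 1]) (simp add: norm_triangle_ineq)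
qed

lemma vanishes_to_order_minus:
  "vanishes_to_order n f \<Longrightarrow> vanishes_to_order n (\<lambda>z. - f z)"
  unfolding vanishes_to_order_def by simp

lemma vanishes_to_order_diff:
  "vanishes_to_order n f \<Longrightarrow> vanishes_to_order n g \<Longrightarrow> vanishes_to_order n (\<lambda>z. f z - g z)"
  using vanishes_to_order_add[of n f "\<lambda>z. - g z"] vanishes_to_order_minus[of n g] by simp

lemma vanishes_to_order_mono:
  assumes "vanishes_to_order m f" "n \<le> m"
  shows "vanishes_to_order n f"
proof -
  have "eventually (\<lambda>z. z \<in> ball 0 1) (nhds (0 :: 'a))"
    by (rule eventually_nhds_in_open) auto
  then have "(\<lambda>z :: 'a. norm z ^ m) \<in> O[nhds 0](\<lambda>z. norm z ^ n)"
    by (intro landau_o.bigI[where c = 1]) (auto elim!: eventually_mono intro!: power_decreasing assms(2))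
  with assms(1) show ?thesis
    unfolding vanishes_to_order_def using landau_o.big_trans by blast
qed

lemma vanishes_to_order_const: "vanishes_to_order 0 (\<lambda>z. c)"
  unfolding vanishes_to_order_def by simp

lemma bounded_linear_vanishes_to_order:
  assumes "bounded_linear f"
  shows "vanishes_to_order 1 f"
proof -
  obtain K where "\<And>x. norm (f x) \<le> norm x * K"
    using bounded_linear.bounded[OF assms] by blast
  then show ?thesis
    by (intro vanishes_to_order_bound[where f = "\<lambda>x. x" and c = K and g = f] always_eventually)
       (simp_all add: vanishes_to_order_def mult.commute)
qed

lemma bounded_bilinear_vanishes_to_order:
  assumes "bounded_bilinear h" "vanishes_to_order m f" "vanishes_to_order n g"
  shows "vanishes_to_order (m + n) (\<lambda>z. h (f z) (g z))"
proof -
  obtain K where "\<And>x y. norm (h x y) \<le> norm x * norm y * K"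
    using bounded_bilinear.bounded[OF assms(1)] by blast
  moreover have "vanishes_to_order (m + n) (\<lambda>z. norm (f z) * norm (g z))"
    using landau_o.big.mult[OF assms(2,3)[unfolded vanishes_to_order_def]]
    unfolding vanishes_to_order_def by (simp add: power_add)
  ultimately show ?thesis
    by (intro vanishes_to_order_bound[where c = K, OF \<open>vanishes_to_order (m + n) (\<lambda>z. norm (f z) * norm (g z))\<close>])
       (simp add: mult.commute)
qed

lemma vanishes_to_order_3_imp_third_order_remainder:
  assumes "vanishes_to_order 3 R"
  shows "third_order_remainder R"
proof -
  \<comment> \<open>\<open>8 = 2 ^ 3\<close>: the norm is at most twice the larger coordinate.\<close>
  have bound: "norm (z :: real \<times> real) ^ 3 \<le> 8 * (\<bar>fst z\<bar> ^ 3 + \<bar>snd z\<bar> ^ 3)" for z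
  proof -
    define m where "m = max \<bar>fst z\<bar> \<bar>snd z\<bar>"
    have "norm z \<le> \<bar>fst z\<bar> + \<bar>snd z\<bar>"
      using norm_Pair_le[of "fst z" "snd z"] by simp
    also have "\<dots> \<le> 2 * m" unfolding m_def by simp
    finally have "norm z ^ 3 \<le> (2 * m) ^ 3"
      by (intro power_mono) auto
    also have "\<dots> = 8 * m ^ 3" by (simp add: power_mult_distrib)
    also have "m ^ 3 \<le> \<bar>fst z\<bar> ^ 3 + \<bar>snd z\<bar> ^ 3"
      unfolding m_def max_def by simp
    finally show ?thesis by simp
  qed
  have "(\<lambda>z :: real \<times> real. norm z ^ 3) \<in> O[nhds 0](\<lambda>(\<alpha>, \<beta>). \<bar>\<alpha>\<bar> ^ 3 + \<bar>\<beta>\<bar> ^ 3)"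
    by (rule landau_o.bigI[where c = 8])
       (use bound in \<open>auto simp: case_prod_unfold intro!: always_eventually\<close>)
  then show ?thesis
    using assms landau_o.big_trans
    unfolding third_order_remainder_def vanishes_to_order_def zero_prod_def by blast
qed

section \<open>Partial derivatives\<close>

lemma vector_derivative_bounded_imp_lipschitz:
  fixes g :: "real \<Rightarrow> 'a::real_normed_vector"
  assumes "\<And>t. t \<in> closed_segment 0 b \<Longrightarrow> (g has_vector_derivative g' t) (at t)"
    and "\<And>t. t \<in> closed_segment 0 b \<Longrightarrow> norm (g' t) \<le> B"
  shows "norm (g b - g 0) \<le> B * \<bar>b\<bar>"
proof -
  have "norm (g b - g 0) \<le> B * norm (b - 0)"
  proof (rule differentiable_bound[where S = "closed_segment 0 b" and f' = "\<lambda>t h. h *\<^sub>R g' t"])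
    show "onorm (\<lambda>h. h *\<^sub>R g' t) \<le> B" if "t \<in> closed_segment 0 b" for t
      using assms(2)[OF that] by (intro onorm_le) (metis mult.commute mult_right_mono norm_ge_zero norm_scaleR real_norm_def)
  qed (use assms(1) in \<open>auto simp: has_vector_derivative_def intro: has_derivative_at_withinI\<close>)
  then show ?thesis by simp
qed

text \<open>Going from the origin to \<open>(a, b)\<close> first along the one axis to \<open>(a, 0)\<close> and then parallel to
  the other uses one partial derivative on each leg; a ball about the origin contains both
  legs together with their endpoint.\<close>

lemma bounded_partials_imp_lipschitz_at_0:
  fixes f :: "real \<times> real \<Rightarrow> 'a::real_normed_vector"
  assumes partials: "has_partials_on (ball 0 r) f f1 f2"
    and B1: "\<And>z. z \<in> ball 0 r \<Longrightarrow> norm (f1 z) \<le> B"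
    and B2: "\<And>z. z \<in> ball 0 r \<Longrightarrow> norm (f2 z) \<le> B"
    and z: "z \<in> ball 0 r"
  shows "norm (f z - f 0) \<le> 2 * B * norm z"
proof -
  obtain a b where ab: "z = (a, b)" by (cases z)
  have leg1: "(t, 0 :: real) \<in> ball 0 r" if "t \<in> closed_segment 0 a" for t
  proof -
    have "\<bar>t\<bar> \<le> \<bar>a\<bar>" using that by (auto simp: closed_segment_eq_real_ivl split: if_splits)
    then show ?thesis using z norm_fst_le[of a b] by (simp add: ab)
  qed
  have leg2: "(a, t) \<in> ball 0 r" if "t \<in> closed_segment 0 b" for t
  proof -
    have "\<bar>t\<bar> \<le> \<bar>b\<bar>" using that by (auto simp: closed_segment_eq_real_ivl split: if_splits)
    then have "norm (a, t) \<le> norm (a, b)"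
      by (simp add: norm_Pair abs_le_square_iff)
    then show ?thesis using z by (simp add: ab)
  qed
  have "norm (f (a, 0) - f (0, 0)) \<le> B * \<bar>a\<bar>"
    by (rule vector_derivative_bounded_imp_lipschitz[where g = "\<lambda>t. f (t, 0)" and g' = "\<lambda>t. f1 (t, 0)"])
       (use leg1 partials B1 in \<open>fastforce simp: has_partials_on_def simp del: mem_ball\<close>)+
  moreover have "norm (f (a, b) - f (a, 0)) \<le> B * \<bar>b\<bar>"
    by (rule vector_derivative_bounded_imp_lipschitz[where g = "\<lambda>t. f (a, t)" and g' = "\<lambda>t. f2 (a, t)"])
       (use leg2 partials B2 in \<open>fastforce simp: has_partials_on_def simp del: mem_ball\<close>)+
  moreover have "0 \<le> B" using B1[OF z] norm_ge_zero order_trans by blast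
  then have "B * \<bar>a\<bar> \<le> B * norm z" "B * \<bar>b\<bar> \<le> B * norm z"
    using norm_fst_le[of a b] norm_snd_le[of b a] by (auto simp: ab intro: mult_left_mono)
  moreover have "norm (f z - f 0) \<le> norm (f (a, b) - f (a, 0)) + norm (f (a, 0) - f (0, 0))"
    using norm_triangle_ineq[of "f (a, b) - f (a, 0)" "f (a, 0) - f (0, 0)"] by (simp add: ab zero_prod_def)
  ultimately show ?thesis by linarith
qed

lemma has_partials_on_subset: "has_partials_on U f f1 f2 \<Longrightarrow> S \<subseteq> U \<Longrightarrow> has_partials_on S f f1 f2"
  unfolding has_partials_on_def by blast

text \<open>The Lipschitz bound is used twice: the continuous second partials are bounded on a small
  ball, which bounds the first partials there, which in turn controls \<open>f\<close>.\<close>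

lemma continuous_second_partials_imp_first_order:
  fixes f :: "real \<times> real \<Rightarrow> 'a::real_normed_vector"
  assumes "open U" "0 \<in> U" "continuous_second_partials_on U f"
  shows "vanishes_to_order 1 (\<lambda>z. f z - f 0)"
proof -
  obtain f1 f2 f11 f12 f21 f22 where
    f: "has_partials_on U f f1 f2"
    and f1: "has_partials_on U f1 f11 f12" and f2: "has_partials_on U f2 f21 f22"
    and cont: "continuous_on U f11" "continuous_on U f12" "continuous_on U f21" "continuous_on U f22"
    using assms(3) unfolding continuous_second_partials_on_def by blast
  obtain r where r: "0 < r" "cball 0 r \<subseteq> U"
    using assms(1,2) open_contains_cball by blast
  have bdd: "\<exists>B. \<forall>z\<in>ball 0 r. norm (g z) \<le> B" if "continuous_on U g" for g :: "real \<times> real \<Rightarrow> 'a"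
  proof -
    have "bounded (g ` cball 0 r)"
      using continuous_on_subset[OF that r(2)]
      by (intro compact_imp_bounded compact_continuous_image) auto
    then show ?thesis by (force simp: bounded_iff)
  qed
  obtain B11 B12 B21 B22 where B:
    "\<forall>z\<in>ball 0 r. norm (f11 z) \<le> B11" "\<forall>z\<in>ball 0 r. norm (f12 z) \<le> B12"
    "\<forall>z\<in>ball 0 r. norm (f21 z) \<le> B21" "\<forall>z\<in>ball 0 r. norm (f22 z) \<le> B22"
    using bdd[OF cont(1)] bdd[OF cont(2)] bdd[OF cont(3)] bdd[OF cont(4)] by blast
  define B where "B = max (max B11 B12) (max B21 B22)"
  have sub: "ball 0 r \<subseteq> U" using r(2) by auto
  have B': "norm (f11 z) \<le> B" "norm (f12 z) \<le> B" "norm (f21 z) \<le> B" "norm (f22 z) \<le> B"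
    if "z \<in> ball 0 r" for z
    using bspec[OF B(1) that] bspec[OF B(2) that] bspec[OF B(3) that] bspec[OF B(4) that]
    unfolding B_def by simp_all
  have "norm (f11 0) \<le> B" using B'(1) r(1) by simp
  then have "0 \<le> B" by (rule order_trans[OF norm_ge_zero])
  have step: "norm (g z) \<le> norm (g 0) + 2 * B * r"
    if "has_partials_on U g g1 g2" "z \<in> ball 0 r"
      "\<And>z. z \<in> ball 0 r \<Longrightarrow> norm (g1 z) \<le> B" "\<And>z. z \<in> ball 0 r \<Longrightarrow> norm (g2 z) \<le> B" for g g1 g2 :: "real \<times> real \<Rightarrow> 'a" and z
  proof -
    have "norm (g z - g 0) \<le> 2 * B * norm z"
      by (rule bounded_partials_imp_lipschitz_at_0[OF has_partials_on_subset[OF that(1) sub] that(3,4,2)])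
    also have "\<dots> \<le> 2 * B * r"
      using that(2) \<open>0 \<le> B\<close> by (intro mult_left_mono) auto
    finally show ?thesis using norm_triangle_sub[of "g z" "g 0"] by linarith
  qed
  define C where "C = max (norm (f1 0)) (norm (f2 0)) + 2 * B * r"
  have "norm (f1 z) \<le> C" if "z \<in> ball 0 r" for z
    using step[OF f1 that B'(1,2)] unfolding C_def by simp
  moreover have "norm (f2 z) \<le> C" if "z \<in> ball 0 r" for z
    using step[OF f2 that B'(3,4)] unfolding C_def by simp
  ultimately have "norm (f z - f 0) \<le> 2 * C * norm z" if "z \<in> ball 0 r" for z
    using bounded_partials_imp_lipschitz_at_0[OF has_partials_on_subset[OF f sub]] that by blast
  then have "eventually (\<lambda>z. norm (f z - f 0) \<le> 2 * C * norm z) (nhds 0)"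
    using eventually_nhds_in_open[of "ball 0 r" "0 :: real \<times> real"] r(1)
    by (auto elim: eventually_mono)
  from vanishes_to_order_bound[OF _ this, of 1] show ?thesis
    by (simp add: vanishes_to_order_def)
qed

section \<open>Matrices and the Hermitian form\<close>

lemma bounded_bilinear_matrix_vector_mult:
  "bounded_bilinear ((*v) :: complex^'n^'m \<Rightarrow> complex^'n \<Rightarrow> complex^'m)"
  unfolding bilinear_conv_bounded_bilinear[symmetric] bilinear_def
  by (intro conjI allI linearI)
     (simp_all add: vec_eq_iff matrix_vector_mult_def algebra_simps sum.distrib scaleR_sum_right)

lemma bounded_bilinear_vector_scalar_mult:
  "bounded_bilinear ((*s) :: complex \<Rightarrow> complex^'n \<Rightarrow> complex^'n)"
  unfolding bilinear_conv_bounded_bilinear[symmetric] bilinear_def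
  by (intro conjI allI linearI) (simp_all add: vec_eq_iff algebra_simps)

lemma bounded_bilinear_hdot: "bounded_bilinear (hdot :: complex^'n \<Rightarrow> complex^'n \<Rightarrow> complex)"
  unfolding bilinear_conv_bounded_bilinear[symmetric] bilinear_def
  by (intro conjI allI linearI)
     (simp_all add: hdot_def algebra_simps sum.distrib scaleR_sum_right)

lemma hdot_simps:
  "hdot w (x + y) = hdot w x + hdot w y" "hdot w (x - y) = hdot w x - hdot w y"
  "hdot w (c *s x) = c * hdot w x" "hdot w 0 = 0"
  by (simp_all add: hdot_def algebra_simps sum.distrib sum_subtractf sum_distrib_left)

lemma hdot_sum: "hdot w (\<Sum>k\<in>S. f k) = (\<Sum>k\<in>S. hdot w (f k))"
  by (induction S rule: infinite_finite_induct) (simp_all add: hdot_simps)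

lemma hdot_eq_0_imp_eq_0:
  assumes "\<And>x. hdot w x = 0"
  shows "w = 0"
  using assms[of "axis j 1" for j] by (simp add: hdot_def axis_def vec_eq_iff if_distrib cong: if_cong)

lemma outer_mult_vec: "(mat c ** outer v w) *v x = (c * hdot w x) *s v"
  by (simp add: vec_eq_iff matrix_vector_mult_def matrix_matrix_mult_def mat_def outer_def hdot_def
      if_distrib if_distribR sum.delta sum_distrib_left sum_distrib_right algebra_simps cong: if_cong)

lemma hdot_mult_left_eigenvector:
  assumes "left_eigenvector M l w"
  shows "hdot w (M *v x) = l * hdot w x"
proof -
  have "hdot w (M *v x) = (\<Sum>b\<in>UNIV. (conj_vec w v* M) $ b * x $ b)"
    unfolding hdot_def conj_vec_def vector_matrix_mult_def matrix_vector_mult_def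
    by (simp add: sum_distrib_left sum_distrib_right algebra_simps) (rule sum.swap)
  also have "\<dots> = l * hdot w x"
    using assms by (simp add: left_eigenvector_def hdot_def conj_vec_def sum_distrib_left algebra_simps)
  finally show ?thesis .
qed

lemma bounded_linear_perturbation: "bounded_linear (\<lambda>z. perturbation E (fst z) (snd z))"
  unfolding perturbation_def by (intro bounded_linear_intros)

lemma perturbation_scaled: "perturbation E (t * \<alpha>) (t * \<beta>) = t *\<^sub>R perturbation E \<alpha> \<beta>"
  by (simp add: perturbation_def scaleR_add_right)

section \<open>Eigensystems and the generalized inverse\<close>

text \<open>If \<open>w k\<close> were orthogonal to \<open>v k\<close>, it would be orthogonal to the whole basis and hence zero.
  Given that, the expansion holds on the basis by biorthogonality, and both of its sides are
  linear.\<close>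

lemma eigensystem_expansion:
  assumes "eigensystem A lam v w"
  shows "hdot (w k) (v k) \<noteq> 0"
    and "x = (\<Sum>k\<in>UNIV. (hdot (w k) x / hdot (w k) (v k)) *s v k)"
proof -
  have span: "vec.span (range v) = UNIV" and orth: "\<And>j k. j \<noteq> k \<Longrightarrow> hdot (w j) (v k) = 0"
    and w: "w k \<noteq> 0" for k
    using assms by (auto simp: eigensystem_def left_eigenvector_def)
  show s: "hdot (w k) (v k) \<noteq> 0" for k
  proof
    assume 0: "hdot (w k) (v k) = 0"
    have "hdot (w k) x = 0" for x
    proof (rule vec.span_induct[where S = "range v" and P = "\<lambda>x. hdot (w k) x = 0"])
      show "vec.subspace {x. hdot (w k) x = 0}" by (auto simp: vec.subspace_def hdot_simps)
      show "\<And>x. x \<in> range v \<Longrightarrow> hdot (w k) x = 0" using 0 orth by (metis imageE)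
    qed (simp add: span)
    then show False using hdot_eq_0_imp_eq_0 w by blast
  qed
  let ?e = "\<lambda>x. \<Sum>k\<in>UNIV. (hdot (w k) x / hdot (w k) (v k)) *s v k"
  show "x = ?e x"
  proof (rule vec.span_induct[where S = "range v" and P = "\<lambda>x. x = ?e x"])
    show "vec.subspace {x. x = ?e x}"
    proof (rule vec.subspaceI, unfold mem_Collect_eq)
      show "x + y = ?e (x + y)" if "x = ?e x" "y = ?e y" for x y
        by (subst that(1), subst that(2))
           (simp add: hdot_simps add_divide_distrib vec.scale_left_distrib sum.distrib)
      have "c *s ?e x = ?e (c *s x)" for c x
        by (simp add: hdot_simps vec.scale_sum_right)
      then show "c *s x = ?e (c *s x)" if "x = ?e x" for c x
        by (metis that)
    qed (simp add: hdot_simps)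
    fix x assume "x \<in> range v"
    then obtain j where j: "x = v j" by auto
    have "?e (v j) = (\<Sum>k\<in>UNIV. if k = j then v j else 0)"
      using s orth by (intro sum.cong) auto
    then show "x = ?e x" by (simp add: j)
  qed (simp add: span)
qed

lemma gen_inv_mult_vec:
  "gen_inv lam v w i \<mu> *v x =
     (\<Sum>k | lam k \<noteq> lam i. (hdot (w k) x / ((lam k - lam i) ^ \<mu> * hdot (w k) (v k))) *s v k)"
proof -
  have sum: "(\<Sum>k\<in>S. f k) *v x = (\<Sum>k\<in>S. f k *v x)" for S and f :: "'a \<Rightarrow> complex^'a^'a"
    by (induction S rule: infinite_finite_induct) (simp_all add: matrix_vector_mult_add_rdistrib)
  show ?thesis unfolding gen_inv_def sum outer_mult_vec by simp
qed


text \<open>In the coordinates given by the \<open>w k\<close>, both \<open>A\<close> and the generalized inverses act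
  diagonally. All identities between them below are therefore checked coordinate by
  coordinate, through \<open>eigensystem_eqI\<close>.\<close>

lemma hdot_gen_inv:
  assumes "eigensystem A lam v w"
  shows "hdot (w k) (gen_inv lam v w i \<mu> *v x) =
    (if lam k = lam i then 0 else hdot (w k) x / (lam k - lam i) ^ \<mu>)"
proof -
  have orth: "\<And>j k. j \<noteq> k \<Longrightarrow> hdot (w j) (v k) = 0"
    using assms by (auto simp: eigensystem_def)
  have "hdot (w k) (gen_inv lam v w i \<mu> *v x) =
      (\<Sum>j | lam j \<noteq> lam i. if j = k then hdot (w k) x / (lam k - lam i) ^ \<mu> else 0)"
    unfolding gen_inv_mult_vec hdot_sum hdot_simps
    using orth eigensystem_expansion(1)[OF assms, of k] by (intro sum.cong) auto
  then show ?thesis by (simp add: sum.delta)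
qed

lemma eigensystem_eqI:
  assumes "eigensystem A lam v w" "\<And>k. hdot (w k) x = hdot (w k) y"
  shows "x = y"
  by (subst eigensystem_expansion(2)[OF assms(1), of x], subst eigensystem_expansion(2)[OF assms(1), of y])
     (simp add: assms(2))

lemma hdot_eigensystem_mult:
  assumes "eigensystem A lam v w"
  shows "hdot (w k) (A *v x) = lam k * hdot (w k) x"
  using assms by (intro hdot_mult_left_eigenvector) (simp add: eigensystem_def)

lemma hdot_eigenvector_eq_0:
  assumes "eigensystem A lam v w" "A *v u = lam i *s u" "lam k \<noteq> lam i"
  shows "hdot (w k) u = 0"
  using hdot_eigensystem_mult[OF assms(1), of k u] assms(2,3) by (simp add: hdot_simps)

lemma gen_inv_eigenvector:
  assumes "eigensystem A lam v w" "A *v u = lam i *s u"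
  shows "gen_inv lam v w i \<mu> *v u = 0"
  by (rule eigensystem_eqI[OF assms(1)])
     (simp add: hdot_gen_inv[OF assms(1)] hdot_eigenvector_eq_0[OF assms] hdot_simps)

lemma gen_inv_2:
  assumes "eigensystem A lam v w"
  shows "gen_inv lam v w i 2 *v x = gen_inv lam v w i 1 *v (gen_inv lam v w i 1 *v x)"
  by (rule eigensystem_eqI[OF assms]) (simp add: hdot_gen_inv[OF assms] power2_eq_square)

lemma hdot_gen_inv_shifted:
  assumes "eigensystem A lam v w"
  shows "hdot (w k) (gen_inv lam v w i 1 *v (A *v x - lam i *s x)) =
    (if lam k = lam i then 0 else hdot (w k) x)"
  by (simp add: hdot_gen_inv[OF assms] hdot_eigensystem_mult[OF assms] hdot_simps
      flip: left_diff_distrib)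

text \<open>The subtracted vector is the part of \<open>x\<close> outside the eigenspace, so \<open>u\<close> is the spectral
  projection of \<open>x\<close>.\<close>

lemma minus_gen_inv_in_eigenspace:
  fixes x :: "complex^'n" and i :: 'n
  assumes "eigensystem A lam v w"
  defines "u \<equiv> x - gen_inv lam v w i 1 *v (A *v x - lam i *s x)"
  shows "A *v u = lam i *s u"
proof -
  have "A *v u - lam i *s u = 0"
    by (rule eigensystem_eqI[OF assms(1)])
       (auto simp: u_def hdot_eigensystem_mult[OF assms(1)] hdot_gen_inv_shifted[OF assms(1)] hdot_simps
         simp del: One_nat_def)
  then show ?thesis by simp
qed

text \<open>The last assumption says that \<open>u\<close> is the spectral projection of \<open>x\<close>; this is the form in
  which the normalization of the eigenvector enters.\<close>

lemma eq_plus_gen_inv: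
  assumes "eigensystem A lam v w" "A *v u = lam i *s u"
    and "\<And>k. lam k = lam i \<Longrightarrow> hdot (w k) x = hdot (w k) u"
  shows "x = u + gen_inv lam v w i 1 *v (A *v x - lam i *s x)"
  by (rule eigensystem_eqI[OF assms(1)])
     (auto simp: assms(3) hdot_gen_inv_shifted[OF assms(1)] hdot_simps
       hdot_eigenvector_eq_0[OF assms(1,2)] simp del: One_nat_def)

section \<open>Second order expansions\<close>

text \<open>On the unperturbed eigenspace the equation for \<open>W\<close> loses \<open>A\<close>, leaving
  \<open>W* L u = (Lam - l) W* u\<close>. Eliminating \<open>Lam - l\<close> between two vectors \<open>u\<close> and \<open>v\<close> gives
  an identity that is homogeneous in \<open>L\<close>. Along the ray through \<open>z\<close> the factor \<open>t\<close> cancels, and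
  \<open>W\<close> converges to its value at the origin. Hence \<open>z\<close> is arbitrary in the conclusion, inside \<open>U\<close> or
  not.\<close>

lemma left_eigenvector_acts_as_scalar:
  fixes A :: "complex^'n^'n" and E :: "real^'n^'n" and W :: "real \<times> real \<Rightarrow> complex^'n"
  defines "L \<equiv> \<lambda>z. perturbation E (fst z) (snd z)"
  assumes U: "open U" "0 \<in> U"
    and left: "\<And>z. z \<in> U \<Longrightarrow> left_eigenvector (A + L z) (Lam z) (W z)"
    and W: "continuous_on U W"
    and eig: "A *v u = l *s u" "A *v v = l *s v"
  shows "hdot (W 0) (L z *v u) * hdot (W 0) v = hdot (W 0) (L z *v v) * hdot (W 0) u"
proof -
  have act: "hdot (W y) (L y *v x) = (Lam y - l) * hdot (W y) x"
    if "y \<in> U" "A *v x = l *s x" for x y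
    using hdot_mult_left_eigenvector[OF left[OF that(1)], of x] that(2)
    by (simp add: matrix_vector_mult_add_rdistrib hdot_simps algebra_simps)
  have scaled: "L (t *\<^sub>R z) = t *\<^sub>R L z" for t
    by (simp add: L_def perturbation_scaled)
  have ray: "((\<lambda>t. t *\<^sub>R z) \<longlongrightarrow> 0) (at 0)"
    by (auto intro!: tendsto_eq_intros)
  have "eventually (\<lambda>t. t *\<^sub>R z \<in> U) (at 0)"
    using topological_tendstoD[OF ray U] .
  then have eq: "eventually (\<lambda>t. hdot (W (t *\<^sub>R z)) (L z *v u) * hdot (W (t *\<^sub>R z)) v
      = hdot (W (t *\<^sub>R z)) (L z *v v) * hdot (W (t *\<^sub>R z)) u) (at (0::real))"
    using eventually_neq_at_within[of 0 0 UNIV]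
  proof eventually_elim
    case (elim t)
    let ?y = "t *\<^sub>R z"
    have "t *\<^sub>R hdot (W ?y) (L z *v x) = (Lam ?y - l) * hdot (W ?y) x"
      if "A *v x = l *s x" for x
      using act[OF elim(1) that] 
      by (simp add: scaled bounded_bilinear.scaleR_left[OF bounded_bilinear_matrix_vector_mult] bounded_bilinear.scaleR_right[OF bounded_bilinear_hdot])
    note * = this
    have "(t *\<^sub>R hdot (W ?y) (L z *v u)) * hdot (W ?y) v = (t *\<^sub>R hdot (W ?y) (L z *v v)) * hdot (W ?y) u"
      unfolding *[OF eig(1)] *[OF eig(2)] by (simp add: mult_ac)
    then have "t *\<^sub>R (hdot (W ?y) (L z *v u) * hdot (W ?y) v) = t *\<^sub>R (hdot (W ?y) (L z *v v) * hdot (W ?y) u)"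
      by simp
    with elim(2) show ?case by simp
  qed
  have "isCont W 0" using U W continuous_on_eq_continuous_at by blast
  then have "((\<lambda>t. W (t *\<^sub>R z)) \<longlongrightarrow> W 0) (at 0)"
    using isCont_tendsto_compose ray by blast
  then have lim: "((\<lambda>t. hdot (W (t *\<^sub>R z)) x) \<longlongrightarrow> hdot (W 0) x) (at 0)" for x
    using bounded_bilinear.tendsto[OF bounded_bilinear_hdot _ tendsto_const] by blast
  have "((\<lambda>t. hdot (W (t *\<^sub>R z)) (L z *v u) * hdot (W (t *\<^sub>R z)) v)
      \<longlongrightarrow> hdot (W 0) (L z *v v) * hdot (W 0) u) (at (0::real))"
    by (rule Lim_transform_eventually[OF tendsto_mult[OF lim lim] eventually_mono[OF eq]]) simp
  from tendsto_unique[OF _ tendsto_mult[OF lim lim] this] show ?thesis by simp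
qed

text \<open>Orders of vanishing add up in every product that occurs; a constant factor has order 0.\<close>

lemmas vanishes_to_order_matrix_vector =
  bounded_bilinear_vanishes_to_order[OF bounded_bilinear_matrix_vector_mult]
lemmas vanishes_to_order_scalar =
  bounded_bilinear_vanishes_to_order[OF bounded_bilinear_vector_scalar_mult]
lemmas vanishes_to_order_times =
  bounded_bilinear_vanishes_to_order[OF bounded_bilinear_mult]
lemmas vanishes_to_order_const_matrix =
  vanishes_to_order_matrix_vector[OF vanishes_to_order_const, simplified]
lemmas vanishes_to_order_const_hdot =
  bounded_bilinear_vanishes_to_order[OF bounded_bilinear_hdot vanishes_to_order_const, simplified]
lemmas vanishes_to_order_const_times =
  vanishes_to_order_times[OF vanishes_to_order_const, simplified]

text \<open>The proof bootstraps. The error term of \<open>\<mu> - m\<close> contains \<open>(\<mu> - m) w* (V - v)\<close>. A first pass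
  knows that \<open>\<mu> - m\<close> has order 1, so this term has order 2, as has \<open>w* L G L v\<close>; thus
  \<open>\<mu> - m\<close> has order 2. In the second pass the term has order 3. The first result is also
  what the expansion of the eigenvector needs.\<close>

lemma eigenvalue_second_order:
  fixes L :: "'b::real_normed_vector \<Rightarrow> complex^'n^'n" and \<mu> :: "'b \<Rightarrow> complex" and w v :: "complex^'n"
  defines "m \<equiv> \<lambda>z. hdot w (L z *v v) / hdot w v"
  assumes L: "vanishes_to_order 1 L" and \<mu>: "vanishes_to_order 1 \<mu>"
    and V: "vanishes_to_order 1 (\<lambda>z. V z - v)"
    and G: "G *v v = 0" "\<And>x. hdot w (G *v x) = 0" and s: "hdot w v \<noteq> 0"
    and eig: "eventually (\<lambda>z. hdot w (L z *v V z) = \<mu> z * hdot w (V z)) (nhds 0)"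
    and scalar: "eventually (\<lambda>z. let u = V z - G *v (\<mu> z *s V z - L z *v V z)
      in hdot w (L z *v u) = m z * hdot w u) (nhds 0)"
  shows "vanishes_to_order 2 (\<lambda>z. \<mu> z - m z)"
    and "vanishes_to_order 3 (\<lambda>z. \<mu> z - m z + hdot w (L z *v (G *v (L z *v v))) / hdot w v)"
proof -
  define D where "D z = V z - v" for z
  have D: "vanishes_to_order 1 D" using V unfolding D_def .
  define g where "g z = hdot w (L z *v (G *v (L z *v v)))" for z
  define r where "r z = hdot w (L z *v (\<mu> z *s (G *v D z))) - hdot w (L z *v (G *v (L z *v D z)))" for z
  have Lc: "vanishes_to_order 1 (\<lambda>z. L z *v v)"
    using vanishes_to_order_matrix_vector[OF L vanishes_to_order_const] by simp
  have g: "vanishes_to_order 2 g"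
    using vanishes_to_order_const_hdot[OF vanishes_to_order_matrix_vector[OF L
        vanishes_to_order_const_matrix[OF Lc]]]
    unfolding g_def by (simp add: numeral_2_eq_2)
  have "vanishes_to_order 3 (\<lambda>z. hdot w (L z *v (\<mu> z *s (G *v D z))))"
    using vanishes_to_order_const_hdot[OF vanishes_to_order_matrix_vector[OF L
        vanishes_to_order_scalar[OF \<mu> vanishes_to_order_const_matrix[OF D]]]]
    by (simp add: numeral_3_eq_3)
  moreover have "vanishes_to_order 3 (\<lambda>z. hdot w (L z *v (G *v (L z *v D z))))"
    using vanishes_to_order_const_hdot[OF vanishes_to_order_matrix_vector[OF L
        vanishes_to_order_const_matrix[OF vanishes_to_order_matrix_vector[OF L D]]]]
    by (simp add: numeral_3_eq_3)
  ultimately have r: "vanishes_to_order 3 r"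
    unfolding r_def by (rule vanishes_to_order_diff)
  have m: "vanishes_to_order 1 m"
    using vanishes_to_order_const_times[OF vanishes_to_order_const_hdot[OF Lc], of "1 / hdot w v"]
    unfolding m_def by simp
  \<comment> \<open>Here \<open>w* L G (\<mu> V - L V) = r - g\<close>, where \<open>g\<close> is the second order term of the eigenvalue
    and \<open>r\<close> collects the contributions of \<open>D\<close>.\<close>
  have key: "eventually (\<lambda>z. \<mu> z - m z = (1 / hdot w v) * (r z - g z - (\<mu> z - m z) * hdot w (D z))) (nhds 0)"
    using eig scalar
  proof eventually_elim
    case (elim z)
    define y where "y = G *v (\<mu> z *s V z - L z *v V z)"
    have y0: "hdot w y = 0" unfolding y_def by (rule G)
    have Vz: "V z = v + D z" by (simp add: D_def)
    have "hdot w (L z *v V z) - hdot w (L z *v y) = m z * hdot w (V z)"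
      using elim(2)[unfolded Let_def, folded y_def] y0
      by (simp add: hdot_simps matrix_vector_mult_diff_distrib)
    moreover have "hdot w (L z *v y) = r z - g z"
      unfolding y_def Vz r_def g_def
      by (simp add: hdot_simps algebra_simps G vector_scalar_commute matrix_vector_right_distrib
          matrix_vector_mult_diff_distrib)
    ultimately have "(\<mu> z - m z) * hdot w (V z) = r z - g z"
      using elim(1) by (simp add: algebra_simps)
    then have "(\<mu> z - m z) * hdot w v = r z - g z - (\<mu> z - m z) * hdot w (D z)"
      by (simp add: Vz hdot_simps algebra_simps)
    with s show ?case by (simp add: field_simps)
  qed
  have "vanishes_to_order 2 (\<lambda>z. (\<mu> z - m z) * hdot w (D z))"
    using vanishes_to_order_times[OF vanishes_to_order_diff[OF \<mu> m] vanishes_to_order_const_hdot[OF D]]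
    by (simp add: numeral_2_eq_2)
  then have "vanishes_to_order 2 (\<lambda>z. (1 / hdot w v) * (r z - g z - (\<mu> z - m z) * hdot w (D z)))"
    using r g by (intro vanishes_to_order_const_times vanishes_to_order_diff)
      (auto intro: vanishes_to_order_mono)
  with key show *: "vanishes_to_order 2 (\<lambda>z. \<mu> z - m z)"
    using vanishes_to_order_cong[of "\<lambda>z. (1 / hdot w v) * (r z - g z - (\<mu> z - m z) * hdot w (D z))"]
    by (simp add: eq_commute)
  have "vanishes_to_order 3 (\<lambda>z. (\<mu> z - m z) * hdot w (D z))"
    using vanishes_to_order_times[OF * vanishes_to_order_const_hdot[OF D]] by (simp add: numeral_3_eq_3)
  then have "vanishes_to_order 3 (\<lambda>z. (1 / hdot w v) * (r z - (\<mu> z - m z) * hdot w (D z)))"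
    using r by (intro vanishes_to_order_const_times vanishes_to_order_diff)
  moreover have "eventually (\<lambda>z. (1 / hdot w v) * (r z - (\<mu> z - m z) * hdot w (D z)) =
      \<mu> z - m z + g z / hdot w v) (nhds 0)"
    using key by eventually_elim (simp add: field_simps s)
  ultimately show "vanishes_to_order 3 (\<lambda>z. \<mu> z - m z + hdot w (L z *v (G *v (L z *v v))) / hdot w v)"
    unfolding g_def by (rule vanishes_to_order_cong[rotated])
qed

text \<open>With \<open>D = V - v\<close> and \<open>G v = 0\<close> the fixed point equation becomes
  \<open>D + G L v = \<mu> G D - G L D\<close>, so \<open>x = D + G L v\<close> has order 2. Inserting \<open>D = x - G L v\<close> on
  the right-hand side exhibits the remainder as
  \<open>\<mu> G x - (\<mu> - m) G G L v - G L x\<close>, each summand of which has order 3.\<close>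

lemma eigenvector_second_order:
  fixes L :: "'b::real_normed_vector \<Rightarrow> complex^'n^'n" and \<mu> m :: "'b \<Rightarrow> complex"
  assumes L: "vanishes_to_order 1 L" and \<mu>: "vanishes_to_order 1 \<mu>"
    and \<mu>m: "vanishes_to_order 2 (\<lambda>z. \<mu> z - m z)"
    and V: "vanishes_to_order 1 (\<lambda>z. V z - v)"
    and G: "G *v v = 0"
    and fixpoint: "eventually (\<lambda>z. V z = v + G *v (\<mu> z *s V z - L z *v V z)) (nhds 0)"
  shows "vanishes_to_order 3 (\<lambda>z. V z - (v - G *v (L z *v v) + G *v (L z *v (G *v (L z *v v)))
    - m z *s (G *v (G *v (L z *v v)))))"
proof -
  define D where "D z = V z - v" for z
  have D: "vanishes_to_order 1 D" using V unfolding D_def .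
  define x where "x z = D z + G *v (L z *v v)" for z
  have eq: "eventually (\<lambda>z. \<mu> z *s (G *v D z) - G *v (L z *v D z) = x z) (nhds 0)"
    using fixpoint
  proof eventually_elim
    case (elim z)
    have Vz: "V z = v + D z" by (simp add: D_def)
    have "D z = G *v (\<mu> z *s V z - L z *v V z)" using elim unfolding D_def by (metis add_diff_cancel_left')
    also have "\<dots> = \<mu> z *s (G *v D z) - G *v (L z *v D z) - G *v (L z *v v)"
      unfolding Vz by (simp add: G vector_scalar_commute matrix_vector_right_distrib
          matrix_vector_mult_diff_distrib)
    finally show ?case unfolding x_def by (metis diff_add_cancel)
  qed
  have "vanishes_to_order 2 (\<lambda>z. \<mu> z *s (G *v D z) - G *v (L z *v D z))"
    using vanishes_to_order_diff[OF vanishes_to_order_scalar[OF \<mu> vanishes_to_order_const_matrix[OF D]]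
        vanishes_to_order_const_matrix[OF vanishes_to_order_matrix_vector[OF L D]]]
    by (simp add: numeral_2_eq_2)
  then have x: "vanishes_to_order 2 x" by (rule vanishes_to_order_cong[OF eq])
  have "vanishes_to_order 3 (\<lambda>z. \<mu> z *s (G *v x z))"
    using vanishes_to_order_scalar[OF \<mu> vanishes_to_order_const_matrix[OF x]]
    by (simp add: numeral_3_eq_3)
  moreover have "vanishes_to_order 3 (\<lambda>z. (\<mu> z - m z) *s (G *v (G *v (L z *v v))))"
    using vanishes_to_order_scalar[OF \<mu>m vanishes_to_order_const_matrix[OF vanishes_to_order_const_matrix[OF
        vanishes_to_order_matrix_vector[OF L vanishes_to_order_const]]]]
    by (simp add: numeral_3_eq_3)
  moreover have "vanishes_to_order 3 (\<lambda>z. G *v (L z *v x z))"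
    using vanishes_to_order_const_matrix[OF vanishes_to_order_matrix_vector[OF L x]]
    by (simp add: numeral_3_eq_3)
  ultimately have "vanishes_to_order 3 (\<lambda>z. \<mu> z *s (G *v x z)
      - (\<mu> z - m z) *s (G *v (G *v (L z *v v))) - G *v (L z *v x z))"
    by (intro vanishes_to_order_diff)
  then show ?thesis
  proof (rule vanishes_to_order_cong[rotated])
    show "eventually (\<lambda>z. \<mu> z *s (G *v x z)
        - (\<mu> z - m z) *s (G *v (G *v (L z *v v))) - G *v (L z *v x z) =
        V z - (v - G *v (L z *v v) + G *v (L z *v (G *v (L z *v v)))
        - m z *s (G *v (G *v (L z *v v))))) (nhds 0)"
      using eq
    proof eventually_elim
      case (elim z)
      have "V z - (v - G *v (L z *v v) + G *v (L z *v (G *v (L z *v v)))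
          - m z *s (G *v (G *v (L z *v v))))
          = x z - G *v (L z *v (G *v (L z *v v))) + m z *s (G *v (G *v (L z *v v)))"
        by (simp add: x_def D_def)
      also have "x z = \<mu> z *s (G *v D z) - G *v (L z *v D z)" using elim by simp
      finally show ?case
        unfolding x_def
        by (simp add: matrix_vector_right_distrib vec.scale_right_distrib vec.scale_left_diff_distrib)
    qed
  qed
qed

theorem theorem3:
  fixes A :: "complex^'n^'n"
    and E :: "real^'n^'n"
    and lam :: "'n \<Rightarrow> complex"
    and v w :: "'n \<Rightarrow> complex^'n"
    and i :: 'n
    and U :: "(real \<times> real) set"
    and Lam :: "real \<times> real \<Rightarrow> complex"
    and V W :: "real \<times> real \<Rightarrow> complex^'n"
  assumes "diagonalizable A"
    and "eigensystem A lam v w"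
    and "semisimple_eigenvalue A (lam i)"
    and "open U" and "(0, 0) \<in> U"
    and "\<And>\<alpha> \<beta>. (\<alpha>, \<beta>) \<in> U \<Longrightarrow>
           right_eigenvector (A + perturbation E \<alpha> \<beta>) (Lam (\<alpha>, \<beta>)) (V (\<alpha>, \<beta>))"
    and "\<And>\<alpha> \<beta>. (\<alpha>, \<beta>) \<in> U \<Longrightarrow>
           left_eigenvector (A + perturbation E \<alpha> \<beta>) (Lam (\<alpha>, \<beta>)) (W (\<alpha>, \<beta>))"
    and "continuous_on U Lam" and "continuous_on U V" and "continuous_on U W"
    and "Lam (0, 0) = lam i" and "V (0, 0) = v i" and "W (0, 0) = w i"
    and "continuous_second_partials_on U Lam"
    and "continuous_second_partials_on U V"
  shows "let s = hdot (w i) (v i);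
             L = perturbation E;
             G = gen_inv lam v w i 1;
             G2 = gen_inv lam v w i 2
         in third_order_remainder (\<lambda>(\<alpha>, \<beta>).
              Lam (\<alpha>, \<beta>) -
                (lam i
                 + 1 / s * hdot (w i) (L \<alpha> \<beta> *v v i)
                 - 1 / s * hdot (w i) ((L \<alpha> \<beta> ** G ** L \<alpha> \<beta>) *v v i)))
          \<and> (normalized_on U lam v w i V \<longrightarrow>
             third_order_remainder (\<lambda>(\<alpha>, \<beta>).
              V (\<alpha>, \<beta>) -
                (v i
                 - (G ** L \<alpha> \<beta>) *v v i
                 + ((G ** L \<alpha> \<beta>) ** (G ** L \<alpha> \<beta>)) *v v i
                 - (1 / s) *s (hdot (w i) (L \<alpha> \<beta> *v v i) *s ((G2 ** L \<alpha> \<beta>) *v v i)))))"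
proof -
  define L where "L z = perturbation E (fst z) (snd z)" for z
  define G where "G = gen_inv lam v w i 1"
  define s where "s = hdot (w i) (v i)"
  define \<mu> where "\<mu> z = Lam z - lam i" for z
  note es = assms(2)
  have U: "open U" "0 \<in> U" using assms(4,5) by (simp_all add: zero_prod_def)
  have at_0: "Lam 0 = lam i" "V 0 = v i" "W 0 = w i" using assms(11-13) by (simp_all add: zero_prod_def)
  have in_U: "eventually (\<lambda>z. z \<in> U) (nhds 0)" using U by (rule eventually_nhds_in_open)
  have s: "s \<noteq> 0" unfolding s_def by (rule eigensystem_expansion(1)[OF es])
  have v: "A *v v i = lam i *s v i" using es by (simp add: eigensystem_def right_eigenvector_def)
  have L: "vanishes_to_order 1 L"
    using bounded_linear_vanishes_to_order[OF bounded_linear_perturbation] unfolding L_def .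
  have \<mu>: "vanishes_to_order 1 \<mu>"
    using continuous_second_partials_imp_first_order[OF U assms(14)] unfolding at_0 \<mu>_def .
  have V: "vanishes_to_order 1 (\<lambda>z. V z - v i)"
    using continuous_second_partials_imp_first_order[OF U assms(15)] unfolding at_0 .
  have Gv: "G *v v i = 0" unfolding G_def by (rule gen_inv_eigenvector[OF es v])
  have hG: "hdot (w i) (G *v x) = 0" for x unfolding G_def by (simp add: hdot_gen_inv[OF es])
  have shifted: "A *v V z - lam i *s V z = \<mu> z *s V z - L z *v V z" if "z \<in> U" for z
    using assms(6)[of "fst z" "snd z"] that
    by (simp add: right_eigenvector_def L_def \<mu>_def matrix_vector_mult_add_rdistrib
        vec.scale_left_diff_distrib algebra_simps)
  have eig: "hdot (w i) (L z *v V z) = \<mu> z * hdot (w i) (V z)" if "z \<in> U" for z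
    using arg_cong[OF shifted[OF that], of "hdot (w i)"]
    by (simp add: hdot_simps hdot_eigensystem_mult[OF es])
  have left: "left_eigenvector (A + perturbation E (fst z) (snd z)) (Lam z) (W z)" if "z \<in> U" for z
    using assms(7)[of "fst z" "snd z"] that by simp
  have scalar: "hdot (w i) (L z *v u) = hdot (w i) (L z *v v i) / s * hdot (w i) u"
    if "A *v u = lam i *s u" for z u
    using left_eigenvector_acts_as_scalar[OF U left assms(10) that v, of z] s
    by (simp add: at_0 s_def L_def field_simps)
  have scalar': "let u = V z - G *v (\<mu> z *s V z - L z *v V z)
      in hdot (w i) (L z *v u) = hdot (w i) (L z *v v i) / s * hdot (w i) u" if "z \<in> U" for z
    unfolding Let_def shifted[OF that, symmetric] G_def
    by (rule scalar[OF minus_gen_inv_in_eigenspace[OF es]])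
  note eigenvalue = eigenvalue_second_order[OF L \<mu> V Gv hG s[unfolded s_def]
      eventually_mono[OF in_U eig] eventually_mono[OF in_U scalar'[unfolded s_def]], folded s_def]
  have "third_order_remainder (\<lambda>(\<alpha>, \<beta>). Lam (\<alpha>, \<beta>) -
      (lam i + 1 / s * hdot (w i) (perturbation E \<alpha> \<beta> *v v i)
       - 1 / s * hdot (w i) ((perturbation E \<alpha> \<beta> ** G ** perturbation E \<alpha> \<beta>) *v v i)))"
    using vanishes_to_order_3_imp_third_order_remainder[OF eigenvalue(2)]
    by (simp add: L_def \<mu>_def case_prod_unfold matrix_vector_mul_assoc algebra_simps matrix_mul_assoc)
  moreover have "third_order_remainder (\<lambda>(\<alpha>, \<beta>). V (\<alpha>, \<beta>) -
      (v i - (G ** perturbation E \<alpha> \<beta>) *v v i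
       + ((G ** perturbation E \<alpha> \<beta>) ** (G ** perturbation E \<alpha> \<beta>)) *v v i
       - (1 / s) *s (hdot (w i) (perturbation E \<alpha> \<beta> *v v i) *s
           ((gen_inv lam v w i 2 ** perturbation E \<alpha> \<beta>) *v v i))))"
    if "normalized_on U lam v w i V"
  proof -
    have "V z = v i + G *v (\<mu> z *s V z - L z *v V z)" if "z \<in> U" for z
      unfolding shifted[OF that, symmetric] G_def
      using \<open>normalized_on U lam v w i V\<close> that
      by (intro eq_plus_gen_inv[OF es v]) (simp add: normalized_on_def)
    from eigenvector_second_order[OF L \<mu> eigenvalue(1) V Gv eventually_mono[OF in_U this]]
    show ?thesis
      by (intro vanishes_to_order_3_imp_third_order_remainder)
         (simp add: L_def G_def case_prod_unfold gen_inv_2[OF es] flip: matrix_vector_mul_assoc)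
  qed
  ultimately show ?thesis
    unfolding Let_def s_def G_def by blast
qed

end
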